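(* For any positive integers $K$ and $r$ with $1\leq r\leq K-1$, there exists a $(K,\binom{K}{r},r)$-computing matrix from which one gets a distributed computing scheme on $K$ nodes with computation load $r$ and communication load $L=\frac{2}{r+1}\left(1-\frac{r}{K}\right)$, with file complexity $F=\binom{K}{r}$. Further, this load satisfies $L<2L^*(r)$, where $L^*(r)=\frac{1}{r}\left(1-\frac{r}{K}\right)$ is the optimal communication load for the computation load $r$.
   Context: Coded MapReduce model: there are $K$ servers (nodes) indexed by $\mathcal{K}$, and an input file divided into $F$ subfiles indexed by $\mathcal{F}$, $|\mathcal{F}|=F\geq K$; $F$ is the file complexity. There are $Q$ output functions $\phi_1,\dots,\phi_Q$ of the whole file, with $\beta=Q/K$ an integer. For $q\in[Q]$, $f\in\mathcal{F}$, a map function $g_{q,f}$ produces from subfile $f$ an intermediate value (IVA) $v_{q,f}=g_{q,f}(f)$, an arbitrary string of $T$ bits, and a reduce function $h_q$ satisfies $\phi_q(\text{all subfiles})=h_q(\{v_{q,f}:f\in\mathcal{F}\})$. A distributed computing scheme has three phases. Map: each subfile is assigned to $r$ servers ($r$ is the computation load); with $\mathcal{M}_k\subseteq\mathcal{F}$ the subfiles assigned to server $k$, server $k$ computes $v_{q,f}$ for all $q\in[Q]$, $f\in\mathcal{M}_k$. Shuffle: server $k$ is responsible for a set $\mathcal{W}_k\subset[Q]$ of $\beta$ functions, these sets being disjoint with union $[Q]$; servers broadcast messages (each a function of the IVAs computed by the transmitting server) so that each server $k$ can recover all $v_{q,f}$, $q\in\mathcal{W}_k$, $f\notin\mathcal{M}_k$,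 from the broadcasts and its own IVAs. Reduce: server $k$ computes $h_q(\{v_{q,f}:f\in\mathcal{F}\})$ for each $q\in\mathcal{W}_k$. The communication load is $L=\frac{\text{total number of bits transmitted in the shuffle phase}}{QFT}$. Computing matrix: a binary ($0/1$) matrix $C$ with rows indexed by a $K$-set $\mathcal{K}$ and columns by an $F$-set $\mathcal{F}$ such that each column has the same number $r$ of $0$'s is a $(K,F,r)$-computing matrix; it defines the scheme in which server $k$ maps subfile $f$ (i.e. $f\in\mathcal{M}_k$) if $C(k,f)=0$ and does not map it if $C(k,f)=1$. That $L^*(r)=\frac{1}{r}(1-\frac{r}{K})$ is the minimum communication load at computation load $r$ is a known result from earlier literature and is taken as the definition of $L^*(r)$ here. *)

theory Defs
  imports Complex_Main "HOL-Library.FuncSet" "HOL-Library.Disjoint_Sets"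
begin

text \<open>A matrix is given by its two finite index sets and its entries; only the entries
  \<open>C k f\<close> with \<open>k \<in> \<K>\<close>, \<open>f \<in> \<F>\<close> matter.\<close>

definition computing_matrix ::
  "nat \<Rightarrow> nat \<Rightarrow> nat \<Rightarrow> 'k set \<Rightarrow> 'f set \<Rightarrow> ('k \<Rightarrow> 'f \<Rightarrow> nat) \<Rightarrow> bool" where
  "computing_matrix K F r \<K> \<F> C \<longleftrightarrow>
     finite \<K> \<and> card \<K> = K \<and> finite \<F> \<and> card \<F> = F \<and>
     (\<forall>k\<in>\<K>. \<forall>f\<in>\<F>. C k f \<in> {0, 1}) \<and>
     (\<forall>f\<in>\<F>. card {k \<in> \<K>. C k f = 0} = r)"

text \<open>The intermediate value (IVA) of output function \<open>q\<close> and subfile \<open>f\<close> is the bit string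
  \<open>v q f\<close>.\<close>

type_synonym 'f ivas = "nat \<Rightarrow> 'f \<Rightarrow> bool list"

text \<open>The output functions are indexed by \<open>{1..num_outputs}\<close>.
  The string \<open>encode k u\<close> is the concatenation of all messages broadcast by server \<open>k\<close> when its
  own IVAs are \<open>u\<close>; \<open>msg_bits k\<close> is its length.
  The string \<open>decode k b u q f\<close> is the value of the IVA \<open>(q, f)\<close> that server \<open>k\<close> recovers from the
  broadcasts \<open>b\<close> of all servers and its own IVAs \<open>u\<close>.\<close>

record ('k, 'f) computing_scheme =
  servers :: "'k set"
  subfiles :: "'f set"
  num_outputs :: nat
  iva_bits :: nat
  mapped :: "'k \<Rightarrow> 'f set"
  assigned :: "'k \<Rightarrow> nat set"
  msg_bits :: "'k \<Rightarrow> nat"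
  encode :: "'k \<Rightarrow> 'f ivas \<Rightarrow> bool list"
  decode :: "'k \<Rightarrow> ('k \<Rightarrow> bool list) \<Rightarrow> 'f ivas \<Rightarrow> 'f ivas"

definition valid_ivas :: "('k, 'f) computing_scheme \<Rightarrow> 'f ivas \<Rightarrow> bool" where
  "valid_ivas S v \<longleftrightarrow>
     (\<forall>q\<in>{1..num_outputs S}. \<forall>f\<in>subfiles S. length (v q f) = iva_bits S)"

text \<open>What server \<open>k\<close> computes in the map phase. All IVAs unknown to \<open>k\<close> are blanked out, so
  anything computed from \<open>own_ivas S k v\<close> depends on the IVAs available at \<open>k\<close> only.\<close>

definition own_ivas :: "('k, 'f) computing_scheme \<Rightarrow> 'k \<Rightarrow> 'f ivas \<Rightarrow> 'f ivas" where
  "own_ivas S k v =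
     (\<lambda>q f. if q \<in> {1..num_outputs S} \<and> f \<in> mapped S k then v q f else [])"

definition broadcasts :: "('k, 'f) computing_scheme \<Rightarrow> 'f ivas \<Rightarrow> 'k \<Rightarrow> bool list" where
  "broadcasts S v = (\<lambda>k. if k \<in> servers S then encode S k (own_ivas S k v) else [])"

definition recovered_iva ::
  "('k, 'f) computing_scheme \<Rightarrow> 'f ivas \<Rightarrow> 'k \<Rightarrow> nat \<Rightarrow> 'f \<Rightarrow> bool list" where
  "recovered_iva S v k q f = decode S k (broadcasts S v) (own_ivas S k v) q f"

text \<open>Message lengths are fixed in advance, so that the number of transmitted bits does not
  depend on the data and no information is carried by the lengths. Recovery is required for
  arbitrary IVAs.\<close>

definition distributed_computing_scheme :: "('k, 'f) computing_scheme \<Rightarrow> bool" where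
  "distributed_computing_scheme S \<longleftrightarrow>
     finite (servers S) \<and> servers S \<noteq> {} \<and>
     finite (subfiles S) \<and> card (subfiles S) \<ge> card (servers S) \<and>
     num_outputs S > 0 \<and> card (servers S) dvd num_outputs S \<and> iva_bits S > 0 \<and>
     (\<forall>k\<in>servers S. mapped S k \<subseteq> subfiles S) \<and>
     (\<forall>k\<in>servers S. card (assigned S k) = num_outputs S div card (servers S)) \<and>
     disjoint_family_on (assigned S) (servers S) \<and>
     (\<Union>k\<in>servers S. assigned S k) = {1..num_outputs S} \<and>
     (\<forall>v. valid_ivas S v \<longrightarrow>
        (\<forall>k\<in>servers S. length (encode S k (own_ivas S k v)) = msg_bits S k) \<and>
        (\<forall>k\<in>servers S. \<forall>q\<in>assigned S k. \<forall>f\<in>subfiles S - mapped S k.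
           recovered_iva S v k q f = v q f))"

definition has_computation_load :: "('k, 'f) computing_scheme \<Rightarrow> nat \<Rightarrow> bool" where
  "has_computation_load S r \<longleftrightarrow>
     (\<forall>f\<in>subfiles S. card {k \<in> servers S. f \<in> mapped S k} = r)"

definition file_complexity :: "('k, 'f) computing_scheme \<Rightarrow> nat" where
  "file_complexity S = card (subfiles S)"

definition communication_load :: "('k, 'f) computing_scheme \<Rightarrow> real" where
  "communication_load S =
     real (\<Sum>k\<in>servers S. msg_bits S k) /
       (real (num_outputs S) * real (file_complexity S) * real (iva_bits S))"

definition scheme_of_matrix ::
  "'k set \<Rightarrow> 'f set \<Rightarrow> ('k \<Rightarrow> 'f \<Rightarrow> nat) \<Rightarrow> ('k, 'f) computing_scheme \<Rightarrow> bool" where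
  "scheme_of_matrix \<K> \<F> C S \<longleftrightarrow>
     servers S = \<K> \<and> subfiles S = \<F> \<and> (\<forall>k\<in>\<K>. mapped S k = {f \<in> \<F>. C k f = 0})"

text \<open>A file is a function \<open>x\<close> giving the content \<open>x f\<close> of each subfile \<open>f\<close>. The arguments
  \<open>\<phi>\<close>, \<open>g\<close>, \<open>h\<close> are the output, map and reduce functions.\<close>

definition mapreduce_functions ::
  "'f set \<Rightarrow> nat \<Rightarrow> nat \<Rightarrow> (nat \<Rightarrow> ('f \<Rightarrow> 'w) \<Rightarrow> 'o) \<Rightarrow> (nat \<Rightarrow> 'f \<Rightarrow> 'w \<Rightarrow> bool list) \<Rightarrow>
    (nat \<Rightarrow> ('f \<Rightarrow> bool list) \<Rightarrow> 'o) \<Rightarrow> bool" where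
  "mapreduce_functions \<F> Q T \<phi> g h \<longleftrightarrow>
     (\<forall>q\<in>{1..Q}. \<forall>f\<in>\<F>. \<forall>w. length (g q f w) = T) \<and>
     (\<forall>q\<in>{1..Q}. \<forall>x. \<phi> q x = h q (\<lambda>f\<in>\<F>. g q f (x f)))"

text \<open>The value server \<open>k\<close> computes in the reduce phase for the output function \<open>q\<close>.\<close>

definition reduce_output ::
  "('k, 'f) computing_scheme \<Rightarrow> (nat \<Rightarrow> ('f \<Rightarrow> bool list) \<Rightarrow> 'o) \<Rightarrow> 'f ivas \<Rightarrow> 'k \<Rightarrow> nat \<Rightarrow> 'o"
  where
  "reduce_output S h v k q =
     h q (\<lambda>f\<in>subfiles S.
            if f \<in> mapped S k then own_ivas S k v q f else recovered_iva S v k q f)"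

definition computes_outputs ::
  "('k, 'f) computing_scheme \<Rightarrow> (nat \<Rightarrow> ('f \<Rightarrow> 'w) \<Rightarrow> 'o) \<Rightarrow>
    (nat \<Rightarrow> 'f \<Rightarrow> 'w \<Rightarrow> bool list) \<Rightarrow> (nat \<Rightarrow> ('f \<Rightarrow> bool list) \<Rightarrow> 'o) \<Rightarrow> bool" where
  "computes_outputs S \<phi> g h \<longleftrightarrow>
     (\<forall>x. \<forall>k\<in>servers S. \<forall>q\<in>assigned S k.
        reduce_output S h (\<lambda>q f. g q f (x f)) k q = \<phi> q x)"

definition optimal_load :: "nat \<Rightarrow> nat \<Rightarrow> real" where
  "optimal_load K r = 1 / real r * (1 - real r / real K)"

end

(* For every set B of r + 1 servers, each k in B misses exactly the subfile indexed by B - {k}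
   among the subfiles indexed by the r-subsets of B. One server a of B sends the bitwise sum of the
   IVAs missed by the other members, each of which knows all summands but its own; any second
   member of B sends in the clear what a misses. Two transmissions per (r + 1)-set and per output
   function of a server add up to 2 * beta * T * (K choose (r + 1)) bits. *)

theory Submission
  imports Defs "HOL-Library.Nat_Bijection"
begin

section \<open>Schemes given by a list of transmissions\<close>

text \<open>The decoder picks any IVAs consistent with what a server sees, so that decodability reduces
  to uniqueness of the missing values.\<close>

definition transmission_scheme ::
  "'k set \<Rightarrow> 'f set \<Rightarrow> nat \<Rightarrow> nat \<Rightarrow> ('k \<Rightarrow> 'f set) \<Rightarrow> ('k \<Rightarrow> nat set) \<Rightarrow>
    'x list \<Rightarrow> ('x \<Rightarrow> 'k) \<Rightarrow> ('x \<Rightarrow> 'f ivas \<Rightarrow> bool list) \<Rightarrow> ('k, 'f) computing_scheme" where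
  "transmission_scheme \<K> \<F> Q T M W txs sender content =
    (let own = (\<lambda>k v q f. if q \<in> {1..Q} \<and> f \<in> M k then v q f else []);
         enc = (\<lambda>k u. concat (map (\<lambda>x. content x u) (filter (\<lambda>x. sender x = k) txs)))
     in \<lparr>servers = \<K>, subfiles = \<F>, num_outputs = Q, iva_bits = T, mapped = M, assigned = W,
         msg_bits = (\<lambda>k. T * length (filter (\<lambda>x. sender x = k) txs)),
         encode = enc,
         decode = (\<lambda>k b u. SOME v. (\<forall>q\<in>{1..Q}. \<forall>f\<in>\<F>. length (v q f) = T) \<and>
                     own k v = u \<and> (\<lambda>l. if l \<in> \<K> then enc l (own l v) else []) = b)\<rparr>)"

lemma transmission_scheme_sel [simp]:
  "servers (transmission_scheme \<K> \<F> Q T M W txs sender content) = \<K>"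
  "subfiles (transmission_scheme \<K> \<F> Q T M W txs sender content) = \<F>"
  "num_outputs (transmission_scheme \<K> \<F> Q T M W txs sender content) = Q"
  "iva_bits (transmission_scheme \<K> \<F> Q T M W txs sender content) = T"
  "mapped (transmission_scheme \<K> \<F> Q T M W txs sender content) = M"
  "assigned (transmission_scheme \<K> \<F> Q T M W txs sender content) = W"
  "msg_bits (transmission_scheme \<K> \<F> Q T M W txs sender content) =
    (\<lambda>k. T * length (filter (\<lambda>x. sender x = k) txs))"
  "encode (transmission_scheme \<K> \<F> Q T M W txs sender content) =
    (\<lambda>k u. concat (map (\<lambda>x. content x u) (filter (\<lambda>x. sender x = k) txs)))"
  by (simp_all add: transmission_scheme_def Let_def)

text \<open>\<open>own_ivas\<close> and \<open>broadcasts\<close> take a finished record, so the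
  definition of its \<open>decode\<close> field spells out their bodies. Unfolding identifies the
  two forms.\<close>

lemma decode_transmission_scheme:
  fixes \<K> \<F> Q T M W txs sender content
  defines "S \<equiv> transmission_scheme \<K> \<F> Q T M W txs sender content"
  shows "decode S k b u = (SOME v. valid_ivas S v \<and> own_ivas S k v = u \<and> broadcasts S v = b)"
  unfolding S_def valid_ivas_def own_ivas_def broadcasts_def
  by (simp add: transmission_scheme_def Let_def cong: if_cong)

text \<open>Blocks of equal length are cut at the same places, so single transmissions can be read
  off from a concatenated message.\<close>

lemma concat_map_inject:
  assumes "concat (map f xs) = concat (map g xs)" and "\<And>x. x \<in> set xs \<Longrightarrow> length (f x) = length (g x)"
    and "x \<in> set xs"
  shows "f x = g x"
  using assms by (induction xs) auto

lemma sum_length_filter_eq: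
  assumes "finite A" and "\<And>x. x \<in> set xs \<Longrightarrow> f x \<in> A"
  shows "(\<Sum>a\<in>A. length (filter (\<lambda>x. f x = a) xs)) = length xs"
  using assms(2)
proof (induction xs)
  case (Cons x xs)
  have "(\<Sum>a\<in>A. length (filter (\<lambda>y. f y = a) (x # xs)))
      = (\<Sum>a\<in>A. (if f x = a then 1 else 0) + length (filter (\<lambda>y. f y = a) xs))"
    by (intro sum.cong) auto
  also have "\<dots> = Suc (length xs)"
    using Cons assms(1) by (simp add: sum.distrib)
  finally show ?case by simp
qed simp

lemma sum_msg_bits_transmission_scheme:
  assumes "finite \<K>" and "\<And>x. x \<in> set txs \<Longrightarrow> sender x \<in> \<K>"
  shows "(\<Sum>k\<in>\<K>. msg_bits (transmission_scheme \<K> \<F> Q T M W txs sender content) k)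
    = T * length txs"
  using assms by (simp add: sum_distrib_left [symmetric] sum_length_filter_eq)

text \<open>By \<open>local\<close>, broadcasts made from own IVAs carry the true contents; by
  \<open>len\<close>, they can be split into single transmissions. The IVAs chosen by the decoder
  thus agree with the true ones on every transmission, and \<open>unique\<close> yields the missing
  values.\<close>

lemma distributed_computing_transmission_scheme:
  fixes \<K> \<F> Q T M W txs sender content
  defines "S \<equiv> transmission_scheme \<K> \<F> Q T M W txs sender content"
  assumes fin: "finite \<K>" "\<K> \<noteq> {}" "finite \<F>" "card \<K> \<le> card \<F>"
    and pos: "0 < Q" "card \<K> dvd Q" "0 < T"
    and M: "\<And>k. k \<in> \<K> \<Longrightarrow> M k \<subseteq> \<F>"
    and W: "\<And>k. k \<in> \<K> \<Longrightarrow> card (W k) = Q div card \<K>" "disjoint_family_on W \<K>"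
      "(\<Union>k\<in>\<K>. W k) = {1..Q}"
    and sender: "\<And>x. x \<in> set txs \<Longrightarrow> sender x \<in> \<K>"
    and len: "\<And>x v. x \<in> set txs \<Longrightarrow> valid_ivas S v \<Longrightarrow> length (content x v) = T"
    and local: "\<And>x v. x \<in> set txs \<Longrightarrow> content x (own_ivas S (sender x) v) = content x v"
    and unique: "\<And>v v' k q f. valid_ivas S v \<Longrightarrow> valid_ivas S v' \<Longrightarrow> k \<in> \<K> \<Longrightarrow> q \<in> W k \<Longrightarrow>
      f \<in> \<F> - M k \<Longrightarrow> own_ivas S k v = own_ivas S k v' \<Longrightarrow>
      (\<And>x. x \<in> set txs \<Longrightarrow> content x v = content x v') \<Longrightarrow> v q f = v' q f"
  shows "distributed_computing_scheme S"
proof -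
  have sel [simp]: "servers S = \<K>" "subfiles S = \<F>" "num_outputs S = Q" "iva_bits S = T"
    "mapped S = M" "assigned S = W"
    "msg_bits S = (\<lambda>k. T * length (filter (\<lambda>x. sender x = k) txs))"
    by (simp_all add: S_def)
  have enc: "encode S k (own_ivas S k v)
      = concat (map (\<lambda>x. content x v) (filter (\<lambda>x. sender x = k) txs))" for k v
    using local by (auto simp: S_def intro!: arg_cong [where f = concat] map_cong)
  have enc_len: "length (encode S k (own_ivas S k v)) = msg_bits S k" if "valid_ivas S v" for k v
  proof -
    have "map (\<lambda>x. length (content x v)) (filter (\<lambda>x. sender x = k) txs)
        = map (\<lambda>x. T) (filter (\<lambda>x. sender x = k) txs)"
      using len [OF _ that] by (intro map_cong) auto
    then show ?thesis
      by (simp add: enc length_concat o_def sum_list_triv del: map_eq_conv)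
  qed
  have "recovered_iva S v k q f = v q f"
    if v: "valid_ivas S v" and k: "k \<in> \<K>" "q \<in> W k" "f \<in> \<F> - M k" for v k q f
  proof -
    define v' where "v' = decode S k (broadcasts S v) (own_ivas S k v)"
    \<comment> \<open>The true \<open>v\<close> is itself consistent with what \<open>k\<close>
      sees, so the choice is not vacuous.\<close>
    have v': "valid_ivas S v'" "own_ivas S k v' = own_ivas S k v" "broadcasts S v' = broadcasts S v"
      using someI [of "\<lambda>w. valid_ivas S w \<and> own_ivas S k w = own_ivas S k v \<and>
        broadcasts S w = broadcasts S v" v] v
      unfolding v'_def S_def decode_transmission_scheme by blast+
    have "content x v' = content x v" if x: "x \<in> set txs" for x
    proof -
      let ?xs = "filter (\<lambda>y. sender y = sender x) txs"
      have "concat (map (\<lambda>y. content y v') ?xs) = concat (map (\<lambda>y. content y v) ?xs)"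
        \<comment> \<open>As \<open>sender x\<close> lies in \<open>\<K>\<close>, its broadcast is
          the encoding and not the default \<open>[]\<close>.\<close>
        using fun_cong [OF v'(3), of "sender x"] sender [OF x] by (simp add: broadcasts_def enc)
      then show ?thesis
        by (rule concat_map_inject) (use x len v v'(1) in auto)
    qed
    then have "v' q f = v q f"
      using unique [OF v'(1) v k v'(2)] by blast
    then show ?thesis
      by (simp add: recovered_iva_def v'_def)
  qed
  then show ?thesis
    unfolding distributed_computing_scheme_def using fin pos M W enc_len by simp
qed

text \<open>Each subfile is either mapped by \<open>k\<close> or has its IVA recovered, so the
  reduce function gets the true IVAs of all subfiles.\<close>

lemma distributed_computing_scheme_computes_outputs:
  assumes S: "distributed_computing_scheme S"
    and mr: "mapreduce_functions (subfiles S) (num_outputs S) (iva_bits S) \<phi> g h"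
  shows "computes_outputs S \<phi> g h"
  unfolding computes_outputs_def
proof (intro allI ballI)
  fix x k q
  assume k: "k \<in> servers S" and q: "q \<in> assigned S k"
  define v where "v = (\<lambda>q f. g q f (x f))"
  have "valid_ivas S v"
    using mr by (auto simp: v_def valid_ivas_def mapreduce_functions_def)
  then have rec: "recovered_iva S v k q f = v q f" if "f \<in> subfiles S - mapped S k" for f
    using S k q that unfolding distributed_computing_scheme_def by blast
  \<comment> \<open>Outside this range \<open>own_ivas\<close> would return the blank
    \<open>[]\<close>.\<close>
  have Q: "q \<in> {1..num_outputs S}"
    using S k q unfolding distributed_computing_scheme_def by blast
  have "reduce_output S h v k q = h q (\<lambda>f\<in>subfiles S. v q f)"
    unfolding reduce_output_def using rec Q
    by (intro arg_cong [where f = "h q"] restrict_ext) (auto simp: own_ivas_def)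
  also have "\<dots> = \<phi> q x"
    using mr Q by (auto simp: v_def mapreduce_functions_def)
  finally show "reduce_output S h (\<lambda>q f. g q f (x f)) k q = \<phi> q x"
    by (simp add: v_def)
qed

section \<open>The binomial computing matrix\<close>

text \<open>The subfile known to exactly the servers in \<open>A\<close> is the number \<open>set_encode A\<close>.\<close>

definition subset_codes :: "nat \<Rightarrow> nat \<Rightarrow> nat set" where
  "subset_codes K r = set_encode ` {A. A \<subseteq> {..<K} \<and> card A = r}"

definition binomial_matrix :: "nat \<Rightarrow> nat \<Rightarrow> nat" where
  "binomial_matrix k f = (if k \<in> set_decode f then 0 else 1)"

lemma set_encode_in_subset_codes:
  assumes "A \<subseteq> {..<K}" "card A = r"
  shows "set_encode A \<in> subset_codes K r"
  using assms by (auto simp: subset_codes_def)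

text \<open>Subsets of \<open>{..<K}\<close> are finite, and on finite sets
  \<open>set_decode\<close> inverts \<open>set_encode\<close>.\<close>

lemma subset_codesE:
  assumes "f \<in> subset_codes K r"
  obtains A where "A \<subseteq> {..<K}" "card A = r" "f = set_encode A" "set_decode f = A"
  using assms finite_subset [OF _ finite_lessThan]
  by (fastforce simp: subset_codes_def)

lemma finite_subset_codes: "finite (subset_codes K r)"
  by (simp add: subset_codes_def)

lemma card_subset_codes: "card (subset_codes K r) = K choose r"
proof -
  have "inj_on set_encode {A. A \<subseteq> {..<K} \<and> card A = r}"
    by (rule inj_on_subset [OF inj_on_set_encode]) (auto intro: finite_subset)
  then show ?thesis
    by (simp add: subset_codes_def card_image n_subsets)
qed

lemma card_binomial_matrix_column:
  assumes "f \<in> subset_codes K r"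
  shows "card {k \<in> {..<K}. binomial_matrix k f = 0} = r"
proof -
  obtain A where A: "A \<subseteq> {..<K}" "card A = r" "set_decode f = A"
    using assms by (rule subset_codesE)
  then have "{k \<in> {..<K}. binomial_matrix k f = 0} = A"
    by (auto simp: binomial_matrix_def split: if_splits)
  then show ?thesis using A by simp
qed

lemma computing_matrix_binomial:
  "computing_matrix K (K choose r) r {..<K} (subset_codes K r) binomial_matrix"
  unfolding computing_matrix_def
  using card_binomial_matrix_column
  by (simp add: finite_subset_codes card_subset_codes binomial_matrix_def)

text \<open>Pascal's rule adds a positive term to the bound for \<open>n\<close>; the case
  \<open>r = n\<close> is direct. This supplies the model's requirement of at least as many subfiles
  as servers.\<close>

lemma le_binomial:
  assumes "1 \<le> r" and "r < n"
  shows "n \<le> n choose r"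
  using assms
proof (induction n arbitrary: r)
  case (Suc n)
  obtain s where s: "r = Suc s" using Suc.prems by (cases r) auto
  show ?case
  proof (cases "r = n")
    case False
    then have "n \<le> n choose r" using Suc by simp
    moreover have "0 < n choose s" using Suc.prems s by (simp add: zero_less_binomial)
    ultimately show ?thesis unfolding s binomial_Suc_Suc by linarith
  qed simp
qed simp

section \<open>The coded shuffle\<close>

text \<open>The \<open>j\<close>-th output function of server \<open>k\<close> has index \<open>k * \<beta> + j + 1\<close>, and
  \<open>missing_iva \<beta> v B j k\<close> is its IVA for the subfile that \<open>k\<close> alone misses in the group \<open>B\<close>.\<close>

definition missing_iva :: "nat \<Rightarrow> nat ivas \<Rightarrow> nat set \<Rightarrow> nat \<Rightarrow> nat \<Rightarrow> bool list" where
  "missing_iva \<beta> v B j k = v (k * \<beta> + j + 1) (set_encode (B - {k}))"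

text \<open>The flag \<open>c\<close> marks the coded transmission of the group \<open>B\<close>.
  \<open>Min B\<close> and \<open>Max B\<close> are a canonical choice of two different
  members.\<close>

fun shuffle_sender :: "bool \<times> nat set \<times> nat \<Rightarrow> nat" where
  "shuffle_sender (c, B, j) = (if c then Min B else Max B)"

text \<open>The bitwise sum modulo 2 is expressed as the parity of the number of summands whose bit
  is set.\<close>

fun shuffle_content :: "nat \<Rightarrow> nat \<Rightarrow> bool \<times> nat set \<times> nat \<Rightarrow> nat ivas \<Rightarrow> bool list" where
  "shuffle_content \<beta> T (c, B, j) v =
    (if c then map (\<lambda>t. odd (\<Sum>k\<in>B - {Min B}. of_bool (missing_iva \<beta> v B j k ! t) :: nat)) [0..<T]
     else missing_iva \<beta> v B j (Min B))"

definition group_list :: "nat \<Rightarrow> nat \<Rightarrow> nat set list" where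
  "group_list K n = (SOME Bs. set Bs = {B. B \<subseteq> {..<K} \<and> card B = n} \<and> distinct Bs)"

lemma
  shows set_group_list: "set (group_list K n) = {B. B \<subseteq> {..<K} \<and> card B = n}"
    and length_group_list: "length (group_list K n) = K choose n"
proof -
  have "\<exists>Bs. set Bs = {B. B \<subseteq> {..<K} \<and> card B = n} \<and> distinct Bs"
    by (rule finite_distinct_list) simp
  then have *: "set (group_list K n) = {B. B \<subseteq> {..<K} \<and> card B = n} \<and> distinct (group_list K n)"
    unfolding group_list_def by (rule someI_ex)
  then show "set (group_list K n) = {B. B \<subseteq> {..<K} \<and> card B = n}" by simp
  show "length (group_list K n) = K choose n"
    using * distinct_card [of "group_list K n"] by (simp add: n_subsets)
qed

definition binomial_scheme :: "nat \<Rightarrow> nat \<Rightarrow> nat \<Rightarrow> nat \<Rightarrow> (nat, nat) computing_scheme" where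
  "binomial_scheme K r \<beta> T =
    transmission_scheme {..<K} (subset_codes K r) (K * \<beta>) T
      (\<lambda>k. {f \<in> subset_codes K r. binomial_matrix k f = 0})
      (\<lambda>k. (\<lambda>j. k * \<beta> + j + 1) ` {..<\<beta>})
      (List.product [True, False] (List.product (group_list K (Suc r)) [0..<\<beta>]))
      shuffle_sender (shuffle_content \<beta> T)"

section \<open>Output indices and the two senders of a group\<close>

lemma block_index_le:
  fixes k \<beta> j K :: nat
  assumes "k < K" and "j < \<beta>"
  shows "k * \<beta> + j + 1 \<le> K * \<beta>"
proof -
  have "k * \<beta> + j + 1 \<le> Suc k * \<beta>" using assms by simp
  also have "\<dots> \<le> K * \<beta>" using assms by (intro mult_right_mono) auto
  finally show ?thesis .
qed

lemma block_index_div: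
  fixes k \<beta> j :: nat
  assumes "j < \<beta>"
  shows "(k * \<beta> + j) div \<beta> = k"
  using assms by simp

lemma distinct_Min_Max:
  assumes "finite B" and "2 \<le> card B"
  shows "Min B \<in> B" "Max B \<in> B" "Min B \<noteq> Max B"
proof -
  have "B \<noteq> {}" using assms by auto
  then show "Min B \<in> B" "Max B \<in> B" using assms by simp_all
  show "Min B \<noteq> Max B"
  proof
    assume "Min B = Max B"
    then have "B \<subseteq> {Min B}"
      using assms(1) by (metis Max_ge Min_le antisym singletonI subsetI)
    then have "card B \<le> 1" using card_mono [of "{Min B}" B] by simp
    then show False using assms(2) by simp
  qed
qed

text \<open>Since \<open>l\<close> stays in \<open>B - {k}\<close>, it maps the subfile with that
  code. This serves both a sender computing its message and a receiver cancelling the other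
  summands.\<close>

lemma missing_iva_own:
  assumes B: "B \<subseteq> {..<K}" "card B = Suc r" and j: "j < \<beta>" and k: "k \<in> B" and l: "l \<in> B" "l \<noteq> k"
  shows "missing_iva \<beta> (own_ivas (binomial_scheme K r \<beta> T) l v) B j k = missing_iva \<beta> v B j k"
proof -
  have fin: "finite B" using B finite_subset by blast
  have "card (B - {k}) = r" using B k fin by simp
  then have "set_encode (B - {k}) \<in> subset_codes K r"
    using B by (intro set_encode_in_subset_codes) auto
  moreover have "l \<in> set_decode (set_encode (B - {k}))"
    using fin l by simp
  moreover have "k < K" using B k by auto
  ultimately show ?thesis
    using block_index_le [of k K j \<beta>] j
    by (simp add: missing_iva_def own_ivas_def binomial_scheme_def binomial_matrix_def)
qed

lemma length_missing_iva:
  assumes "valid_ivas (binomial_scheme K r \<beta> T) v"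
    and "B \<subseteq> {..<K}" "card B = Suc r" "j < \<beta>" "k \<in> B"
  shows "length (missing_iva \<beta> v B j k) = T"
proof -
  have "card (B - {k}) = r" using assms finite_subset [of B] by simp
  then have "set_encode (B - {k}) \<in> subset_codes K r"
    using assms by (intro set_encode_in_subset_codes) auto
  moreover have "k < K" using assms by auto
  ultimately show ?thesis
    using assms(1) block_index_le [of k K j \<beta>] assms(4)
    by (simp add: missing_iva_def valid_ivas_def binomial_scheme_def)
qed

text \<open>\<open>Min B\<close> receives its value in the clear. Any other member knows all
  summands of the coded transmission except its own, so the parity determines each bit of that
  one.\<close>

lemma missing_iva_unique:
  assumes v: "valid_ivas (binomial_scheme K r \<beta> T) v" "valid_ivas (binomial_scheme K r \<beta> T) v'"
    and B: "B \<subseteq> {..<K}" "card B = Suc r" and j: "j < \<beta>" and k: "k \<in> B"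
    and own: "own_ivas (binomial_scheme K r \<beta> T) k v = own_ivas (binomial_scheme K r \<beta> T) k v'"
    and content: "\<And>c. shuffle_content \<beta> T (c, B, j) v = shuffle_content \<beta> T (c, B, j) v'"
  shows "missing_iva \<beta> v B j k = missing_iva \<beta> v' B j k"
proof (cases "k = Min B")
  case True
  then show ?thesis using content [of False] by simp
next
  case False
  have fin: "finite B" using B finite_subset by blast
  have others: "missing_iva \<beta> v B j l = missing_iva \<beta> v' B j l" if "l \<in> B" "l \<noteq> k" for l
    using missing_iva_own [OF B j that(1) k, of T v] missing_iva_own [OF B j that(1) k, of T v']
      that own by simp
  show ?thesis
  proof (rule nth_equalityI)
    show "length (missing_iva \<beta> v B j k) = length (missing_iva \<beta> v' B j k)"
      using v B j k by (simp add: length_missing_iva)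
    fix t assume "t < length (missing_iva \<beta> v B j k)"
    then have t: "t < T" using v(1) B j k by (simp add: length_missing_iva)
    define s where "s w = (\<Sum>l\<in>B - {Min B}. of_bool (missing_iva \<beta> w B j l ! t) :: nat)" for w
    define s' where "s' w = (\<Sum>l\<in>B - {Min B} - {k}. of_bool (missing_iva \<beta> w B j l ! t) :: nat)" for w
    \<comment> \<open>Because \<open>k\<close> differs from \<open>Min B\<close>, its own bit is one
      of the summands and can be split off.\<close>
    have s: "s w = of_bool (missing_iva \<beta> w B j k ! t) + s' w" for w
      unfolding s_def s'_def using fin k False by (intro sum.remove) auto
    have "odd (s v) = odd (s v')"
      using arg_cong [OF content [of True], of "\<lambda>xs. xs ! t"] t by (simp add: s_def)
    moreover have "s' v = s' v'"
      unfolding s'_def using others by (intro sum.cong) auto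
    \<comment> \<open>With equal remainders \<open>s'\<close>, equal parity of \<open>s\<close>
      forces the two bits, each 0 or 1, to coincide.\<close>
    ultimately show "missing_iva \<beta> v B j k ! t = missing_iva \<beta> v' B j k ! t"
      by (auto simp: s)
  qed
qed

lemma distributed_computing_binomial_scheme:
  assumes r: "1 \<le> r" "r < K" and \<beta>: "0 < \<beta>" and T: "0 < T"
  shows "distributed_computing_scheme (binomial_scheme K r \<beta> T)"
  unfolding binomial_scheme_def
\<comment> \<open>Folding back makes the lemmas about \<open>binomial_scheme\<close> applicable to
  the new goals.\<close>
proof (rule distributed_computing_transmission_scheme, unfold binomial_scheme_def [symmetric])
  let ?S = "binomial_scheme K r \<beta> T"
  let ?W = "\<lambda>k. (\<lambda>j. k * \<beta> + j + 1) ` {..<\<beta>}"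
  let ?txs = "List.product [True, False] (List.product (group_list K (Suc r)) [0..<\<beta>])"
  have tx: "(c, B, j) \<in> set ?txs \<longleftrightarrow> B \<subseteq> {..<K} \<and> card B = Suc r \<and> j < \<beta>" for c B j
    by (auto simp: set_group_list)
  \<comment> \<open>From \<open>1 \<le> r\<close> a group has at least two members, hence two
    different senders.\<close>
  have MM: "finite B" "Min B \<in> B" "Max B \<in> B" "Min B \<noteq> Max B"
    if "B \<subseteq> {..<K}" "card B = Suc r" for B
  proof -
    show "finite B" using that finite_subset by blast
    then show "Min B \<in> B" "Max B \<in> B" "Min B \<noteq> Max B"
      using distinct_Min_Max [of B] that r by simp_all
  qed
  show "card {..<K} \<le> card (subset_codes K r)"
    using le_binomial r by (simp add: card_subset_codes)
  show "card (?W k) = K * \<beta> div card {..<K}" for k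
    using r by (subst card_image) (auto simp: inj_on_def)
  show "disjoint_family_on ?W {..<K}"
  proof -
    have "k = l" if "k * \<beta> + i = l * \<beta> + j" "i < \<beta>" "j < \<beta>" for k l i j
      using block_index_div [of i \<beta> k] block_index_div [of j \<beta> l] that by simp
    then show ?thesis by (auto simp: disjoint_family_on_def)
  qed
  show "(\<Union>k\<in>{..<K}. ?W k) = {1..K * \<beta>}"
  proof (intro equalityI subsetI)
    fix q assume "q \<in> (\<Union>k\<in>{..<K}. ?W k)"
    then show "q \<in> {1..K * \<beta>}" using block_index_le by auto
  next
    fix q assume q: "q \<in> {1..K * \<beta>}"
    \<comment> \<open>Output indices start at 1; after the shift, quotient and remainder by
      \<open>\<beta>\<close> give the server and the position in its block.\<close>
    then have "q - 1 < K * \<beta>" by auto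
    then have "(q - 1) div \<beta> < K" by (rule less_mult_imp_div_less)
    moreover from q have "q = (q - 1) div \<beta> * \<beta> + (q - 1) mod \<beta> + 1" by simp
    moreover have "(q - 1) mod \<beta> < \<beta>" using \<beta> by simp
    ultimately show "q \<in> (\<Union>k\<in>{..<K}. ?W k)" by blast
  qed
  fix x :: "bool \<times> nat set \<times> nat" and v
  assume x: "x \<in> set ?txs"
  obtain c B j where xe: "x = (c, B, j)" by (cases x)
  then have B: "B \<subseteq> {..<K}" "card B = Suc r" and j: "j < \<beta>" using x tx by auto
  show "shuffle_sender x \<in> {..<K}"
    using MM [OF B] B(1) xe by auto
  \<comment> \<open>\<open>Min B\<close> sums only values missed by others, and \<open>Max B\<close>
    sends the value missed by \<open>Min B\<close>, so both know what they send.\<close>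
  show "shuffle_content \<beta> T x (own_ivas ?S (shuffle_sender x) v) = shuffle_content \<beta> T x v"
    using MM [OF B] missing_iva_own [OF B j] xe by auto
  show "length (shuffle_content \<beta> T x v) = T" if "valid_ivas ?S v"
    using length_missing_iva [OF that B j] MM [OF B] xe by simp
next
  let ?S = "binomial_scheme K r \<beta> T"
  fix v v' k q f
  assume v: "valid_ivas ?S v" "valid_ivas ?S v'" and k: "k \<in> {..<K}"
    and q: "q \<in> (\<lambda>j. k * \<beta> + j + 1) ` {..<\<beta>}"
    and f: "f \<in> subset_codes K r - {f \<in> subset_codes K r. binomial_matrix k f = 0}"
    and own: "own_ivas ?S k v = own_ivas ?S k v'"
    and content: "\<And>x. x \<in> set (List.product [True, False]
      (List.product (group_list K (Suc r)) [0..<\<beta>])) \<Longrightarrow>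
      shuffle_content \<beta> T x v = shuffle_content \<beta> T x v'"
  obtain j where j: "j < \<beta>" "q = k * \<beta> + j + 1" using q by auto
  from f have "f \<in> subset_codes K r" by simp
  then obtain A where A: "A \<subseteq> {..<K}" "card A = r" "f = set_encode A" "set_decode f = A"
    by (rule subset_codesE)
  have kA: "k \<notin> A" using f A(4) by (auto simp: binomial_matrix_def)
  \<comment> \<open>The group serving \<open>k\<close> for the subfile of \<open>A\<close> is
    \<open>insert k A\<close>: removing \<open>k\<close> gives \<open>A\<close> back.\<close>
  have B: "insert k A \<subseteq> {..<K}" "card (insert k A) = Suc r"
    using A k kA finite_subset [of A] by auto
  have "missing_iva \<beta> v (insert k A) j k = missing_iva \<beta> v' (insert k A) j k"
    using v B j(1) _ own
  proof (rule missing_iva_unique)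
    show "shuffle_content \<beta> T (c, insert k A, j) v = shuffle_content \<beta> T (c, insert k A, j) v'" for c
      by (rule content) (use B j in \<open>auto simp: set_group_list\<close>)
  qed simp
  then show "v q f = v' q f"
    using kA A(3) j(2) by (simp add: missing_iva_def)
qed (use r \<beta> T in \<open>auto simp: finite_subset_codes\<close>)

section \<open>Communication load\<close>

lemma sum_msg_bits_binomial_scheme:
  "(\<Sum>k\<in>servers (binomial_scheme K r \<beta> T). msg_bits (binomial_scheme K r \<beta> T) k)
    = T * (2 * ((K choose Suc r) * \<beta>))"
  if "1 \<le> r"
proof -
  have "shuffle_sender (c, B, j) < K" if "B \<subseteq> {..<K}" "card B = Suc r" for c B j
    using distinct_Min_Max [of B] that finite_subset [of B] \<open>1 \<le> r\<close> by auto
  then show ?thesis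
    unfolding binomial_scheme_def
    by (simp only: transmission_scheme_sel(1), subst sum_msg_bits_transmission_scheme)
      (auto simp: set_group_list length_group_list simp del: shuffle_sender.simps)
qed

lemma communication_load_binomial_scheme:
  assumes r: "1 \<le> r" "r < K" and \<beta>: "0 < \<beta>" and T: "0 < T"
  shows "communication_load (binomial_scheme K r \<beta> T) = 2 / (real r + 1) * (1 - real r / real K)"
proof -
  \<comment> \<open>Both sides equal \<open>K * ((K - 1) choose r)\<close>; the identity turns the
    ratio of binomials in the load into \<open>(K - r) / (r + 1)\<close>.\<close>
  have "Suc r * (K choose Suc r) = (K - r) * (K choose r)"
    by (metis binomial_absorb_comp binomial_absorption)
  then have "real (Suc r * (K choose Suc r)) = real ((K - r) * (K choose r))" by simp
  then have eq: "(real r + 1) * real (K choose Suc r) = (real K - real r) * real (K choose r)"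
    using r by (simp add: of_nat_diff algebra_simps)
  have pos: "0 < real (K choose r)" using r by (simp add: zero_less_binomial)
  have "communication_load (binomial_scheme K r \<beta> T)
      = real (T * (2 * ((K choose Suc r) * \<beta>))) / (real (K * \<beta>) * real (K choose r) * real T)"
    unfolding communication_load_def sum_msg_bits_binomial_scheme [OF r(1)]
    by (simp add: binomial_scheme_def file_complexity_def card_subset_codes)
  also have "\<dots> = 2 * real (K choose Suc r) / (real K * real (K choose r))"
    using \<beta> T by simp
  also have "real (K choose Suc r) = (real K - real r) * real (K choose r) / (real r + 1)"
    using eq by (simp add: eq_divide_eq mult.commute)
  also have "2 * \<dots> / (real K * real (K choose r)) = 2 / (real r + 1) * ((real K - real r) / real K)"
    using pos by simp
  also have "(real K - real r) / real K = 1 - real r / real K"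
    using r by (simp add: diff_divide_distrib)
  finally show ?thesis .
qed

theorem corollary1:
  fixes K r :: nat
  assumes "0 < K" and "1 \<le> r" and "r \<le> K - 1"
  shows "\<exists>(\<K> :: nat set) (\<F> :: nat set) (C :: nat \<Rightarrow> nat \<Rightarrow> nat).
     computing_matrix K (K choose r) r \<K> \<F> C \<and>
     (\<forall>Q T. 0 < Q \<and> K dvd Q \<and> 0 < T \<longrightarrow>
       (\<exists>S :: (nat, nat) computing_scheme.
          num_outputs S = Q \<and> iva_bits S = T \<and>
          scheme_of_matrix \<K> \<F> C S \<and>
          distributed_computing_scheme S \<and>
          (\<forall>(\<phi> :: nat \<Rightarrow> (nat \<Rightarrow> 'w) \<Rightarrow> 'o) g h.
             mapreduce_functions \<F> Q T \<phi> g h \<longrightarrow> computes_outputs S \<phi> g h) \<and>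
          has_computation_load S r \<and>
          file_complexity S = K choose r \<and>
          communication_load S = 2 / (real r + 1) * (1 - real r / real K) \<and>
          communication_load S < 2 * optimal_load K r))"
proof (intro exI conjI allI impI)
  show "computing_matrix K (K choose r) r {..<K} (subset_codes K r) binomial_matrix"
    by (rule computing_matrix_binomial)
  fix Q T :: nat
  assume QT: "0 < Q \<and> K dvd Q \<and> 0 < T"
  have r: "1 \<le> r" "r < K" using assms by auto
  \<comment> \<open>The number of output functions per server, positive because \<open>K\<close>
    divides the positive \<open>Q\<close>.\<close>
  define \<beta> where "\<beta> = Q div K"
  have Q: "Q = K * \<beta>" and \<beta>: "0 < \<beta>" using QT by (auto simp: \<beta>_def)
  let ?S = "binomial_scheme K r \<beta> T"
  show "num_outputs ?S = Q" "iva_bits ?S = T" "file_complexity ?S = K choose r"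
    by (simp_all add: binomial_scheme_def Q file_complexity_def card_subset_codes)
  show "scheme_of_matrix {..<K} (subset_codes K r) binomial_matrix ?S"
    by (simp add: scheme_of_matrix_def binomial_scheme_def)
  show dcs: "distributed_computing_scheme ?S"
    using distributed_computing_binomial_scheme r \<beta> QT by blast
  show "computes_outputs ?S \<phi> g h"
    if "mapreduce_functions (subset_codes K r) Q T \<phi> g h" for \<phi> :: "nat \<Rightarrow> (nat \<Rightarrow> 'w) \<Rightarrow> 'o" and g h
    by (rule distributed_computing_scheme_computes_outputs [OF dcs])
      (use that in \<open>simp add: binomial_scheme_def Q\<close>)
  show "has_computation_load ?S r"
    using card_binomial_matrix_column
    by (fastforce simp: has_computation_load_def binomial_scheme_def intro!: arg_cong [where f = card])
  show load: "communication_load ?S = 2 / (real r + 1) * (1 - real r / real K)"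
    using communication_load_binomial_scheme r \<beta> QT by blast
  \<comment> \<open>The inequality is strict because \<open>r < K\<close> makes the common factor
    \<open>1 - r / K\<close> positive.\<close>
  have "2 / (real r + 1) * (1 - real r / real K) < 2 / real r * (1 - real r / real K)"
    using r by (intro mult_strict_right_mono) (auto simp: field_simps)
  then show "communication_load ?S < 2 * optimal_load K r"
    by (simp add: load optimal_load_def)
qed

end
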